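(* Let $(X,\|\cdot\|)$ be a Banach space and let $U:X\to X$ be a mapping with the property that there exists a positive integer $N$ such that $U^N$ is a $(b,\theta)$-enriched contraction for some $b\in[0,\infty)$ and $\theta\in[0,b+1)$, i.e. $\|b(x-y)+U^Nx-U^Ny\|\le\theta\|x-y\|$ for all $x,y\in X$. Then: (i) $U$ has exactly one fixed point: $Fix(U)=\{p\}$ for some $p\in X$. (ii) There exists $\lambda\in(0,1]$ such that, for every $x_0\in X$, the sequence $\{x_n\}_{n=0}^\infty$ given by $x_{n+1}=(1-\lambda)x_n+\lambda U^Nx_n$, $n\ge0$, converges to $p$.
   Context: For a mapping $U:X\to X$, $Fix(U)=\{a\in X:U(a)=a\}$, and the iterates are $U^0=I$ (the identity map) and $U^n=U^{n-1}\circ U$ for $n\ge1$. A mapping $T:X\to X$ on a linear normed space $(X,\|\cdot\|)$ is a $(b,\theta)$-enriched contraction, where $b\in[0,\infty)$ and $\theta\in[0,b+1)$, if $\|b(x-y)+Tx-Ty\|\le\theta\|x-y\|$ for all $x,y\in X$. *)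

theory Defs
  imports "HOL-Analysis.Analysis"
begin

definition Fix :: "('a \<Rightarrow> 'a) \<Rightarrow> 'a set" where
  "Fix U = {a. U a = a}"

definition enriched_contraction ::
    "real \<Rightarrow> real \<Rightarrow> ('a::real_normed_vector \<Rightarrow> 'a) \<Rightarrow> bool" where
  "enriched_contraction b \<theta> T \<longleftrightarrow>
     b \<in> {0..} \<and> \<theta> \<in> {0..<b + 1} \<and>
     (\<forall>x y. norm (b *\<^sub>R (x - y) + T x - T y) \<le> \<theta> * norm (x - y))"

primrec krasnoselskij ::
    "real \<Rightarrow> ('a::real_vector \<Rightarrow> 'a) \<Rightarrow> 'a \<Rightarrow> nat \<Rightarrow> 'a" where
  "krasnoselskij lam T x\<^sub>0 0 = x\<^sub>0"
| "krasnoselskij lam T x\<^sub>0 (Suc n) =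
     (1 - lam) *\<^sub>R krasnoselskij lam T x\<^sub>0 n + lam *\<^sub>R T (krasnoselskij lam T x\<^sub>0 n)"

end

theory Submission imports Defs begin

text \<open>
  Put \<open>T = U ^^ N\<close> and average it with the identity with weight \<open>\<lambda> = 1 / (b + 1)\<close>:
  the map \<open>x \<mapsto> (1 - \<lambda>) x + \<lambda> T x\<close> equals \<open>x \<mapsto> (b x + T x) / (b + 1)\<close>, so the enriched
  contraction inequality, divided by \<open>b + 1\<close>, says exactly that the averaged map is a Banach
  contraction with constant \<open>\<theta> / (b + 1) < 1\<close>. Averaging with a nonzero weight does not change
  fixed points, hence \<open>T\<close> has a unique fixed point \<open>p\<close>, and the Krasnoselskij iteration of \<open>T\<close>, which
  is the Picard iteration of the averaged map, approaches \<open>p\<close> geometrically.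

  The passage from \<open>U ^^ N\<close> back to \<open>U\<close> uses no metric: \<open>U\<close> commutes with its iterates, so
  \<open>U p\<close> is again a fixed point of \<open>U ^^ N\<close>, and uniqueness forces \<open>U p = p\<close>.
\<close>

definition averaged :: "real \<Rightarrow> ('a::real_vector \<Rightarrow> 'a) \<Rightarrow> 'a \<Rightarrow> 'a" where
  "averaged lam T x = (1 - lam) *\<^sub>R x + lam *\<^sub>R T x"

lemma Fix_averaged:
  assumes "lam \<noteq> 0"
  shows "Fix (averaged lam T) = Fix T"
proof -
  have "averaged lam T x = x + lam *\<^sub>R (T x - x)" for x
    by (simp add: averaged_def algebra_simps)
  then show ?thesis
    using assms by (simp add: Fix_def)
qed

text \<open>
  The weight \<open>1 / (b + 1)\<close> is the one for which the difference of two averaged values is a scalar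
  multiple of the vector \<open>b *\<^sub>R (x - y) + T x - T y\<close> in the enriched contraction inequality.
\<close>

lemma averaged_contraction:
  fixes T :: "'a::real_normed_vector \<Rightarrow> 'a"
  assumes "enriched_contraction b \<theta> T"
  shows "dist (averaged (1 / (b + 1)) T x) (averaged (1 / (b + 1)) T y)
           \<le> \<theta> / (b + 1) * dist x y"
proof -
  have b: "b + 1 > 0" and T: "norm (b *\<^sub>R (x - y) + T x - T y) \<le> \<theta> * norm (x - y)"
    using assms by (auto simp: enriched_contraction_def)
  define l where "l = 1 / (b + 1)"
  have "1 - l = l * b"
    using b by (simp add: l_def field_simps)
  then have "averaged l T x - averaged l T y = l *\<^sub>R (b *\<^sub>R (x - y) + T x - T y)"
    by (simp add: averaged_def scaleR_right_diff_distrib scaleR_right_distrib)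
  then have "dist (averaged (1 / (b + 1)) T x) (averaged (1 / (b + 1)) T y)
      = norm (b *\<^sub>R (x - y) + T x - T y) / (b + 1)"
    using b by (simp add: dist_norm l_def)
  also have "\<dots> \<le> \<theta> * norm (x - y) / (b + 1)"
    using T b by (intro divide_right_mono) auto
  finally show ?thesis
    by (simp add: dist_norm)
qed

lemma krasnoselskij_eq_funpow_averaged:
  "krasnoselskij lam T x n = (averaged lam T ^^ n) x"
  by (induction n) (simp_all add: averaged_def)

lemma contraction_iterates_tendsto_fixpoint:
  fixes f :: "'a::metric_space \<Rightarrow> 'a"
  assumes "0 \<le> c" "c < 1" and f: "\<And>x y. dist (f x) (f y) \<le> c * dist x y" and p: "f p = p"
  shows "(\<lambda>n. (f ^^ n) x) \<longlonglongrightarrow> p"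
proof -
  have bound: "dist ((f ^^ n) x) p \<le> c ^ n * dist x p" for n
  proof (induction n)
    case (Suc n)
    have "dist ((f ^^ Suc n) x) p \<le> c * dist ((f ^^ n) x) p"
      using f[of "(f ^^ n) x" p] p by simp
    also have "\<dots> \<le> c * (c ^ n * dist x p)"
      using Suc \<open>0 \<le> c\<close> by (rule mult_left_mono)
    finally show ?case
      by (simp add: mult.assoc)
  qed simp
  have "(\<lambda>n. c ^ n * dist x p) \<longlonglongrightarrow> 0"
    using assms(1,2) by (intro tendsto_mult_left_zero LIMSEQ_realpow_zero)
  then have "(\<lambda>n. dist ((f ^^ n) x) p) \<longlonglongrightarrow> 0"
    by (rule tendsto_sandwich[OF always_eventually always_eventually tendsto_const, rotated 2])
      (simp_all only: bound zero_le_dist simp_thms)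
  then show ?thesis
    by (rule tendsto_dist_iff[THEN iffD2])
qed

text \<open>
  The map \<open>U\<close> sends fixed points of its iterate to fixed points of its iterate, so a unique one is
  sent to itself; conversely, every fixed point of \<open>U\<close> is one of the iterate.
\<close>

lemma Fix_eq_singleton_if_iterate:
  assumes "Fix (U ^^ N) = {p}"
  shows "Fix U = {p}"
proof -
  have unique: "(U ^^ N) x = x \<longleftrightarrow> x = p" for x
    using assms by (auto simp: Fix_def)
  have "(U ^^ N) (U p) = U p"
    using unique[of p] by (simp flip: funpow_swap1)
  then have "U p = p"
    by (simp add: unique)
  moreover have "x = p" if "U x = x" for x
  proof -
    have "(U ^^ n) x = x" for n
      by (induction n) (simp_all add: that)
    then show ?thesis
      using unique by blast
  qed
  ultimately show ?thesis
    unfolding Fix_def by blast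
qed

theorem theorem4:
  fixes U :: "'a::banach \<Rightarrow> 'a" and N :: nat and b \<theta> :: real
  assumes "N \<ge> 1"
    and "enriched_contraction b \<theta> (U ^^ N)"
  shows "\<exists>p. Fix U = {p} \<and>
           (\<exists>lam\<in>{0<..1}. \<forall>x\<^sub>0. krasnoselskij lam (U ^^ N) x\<^sub>0 \<longlonglongrightarrow> p)"
proof -
  define lam where "lam = 1 / (b + 1)"
  define f where "f = averaged lam (U ^^ N)"
  define c where "c = \<theta> / (b + 1)"
  have "b \<ge> 0" "\<theta> \<ge> 0" "\<theta> < b + 1"
    using assms(2) by (auto simp: enriched_contraction_def)
  then have c: "0 \<le> c" "c < 1" and lam: "lam \<in> {0<..1}"
    by (auto simp: c_def lam_def)
  have f: "dist (f x) (f y) \<le> c * dist x y" for x y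
    unfolding f_def lam_def c_def using assms(2) by (rule averaged_contraction)
  have "\<exists>!p. f p = p"
    using c f by (intro banach_fix_type) auto
  then obtain p where p: "Fix f = {p}"
    unfolding Fix_def by blast
  then have "Fix (U ^^ N) = {p}"
    using Fix_averaged[of lam "U ^^ N"] lam by (simp add: f_def)
  then have "Fix U = {p}"
    by (rule Fix_eq_singleton_if_iterate)
  moreover have "krasnoselskij lam (U ^^ N) x \<longlonglongrightarrow> p" for x
  proof -
    have "f p = p"
      using p by (auto simp: Fix_def)
    with c f have "(\<lambda>n. (f ^^ n) x) \<longlonglongrightarrow> p"
      by (rule contraction_iterates_tendsto_fixpoint)
    then show ?thesis
      by (simp add: f_def krasnoselskij_eq_funpow_averaged[symmetric])
  qed
  ultimately show ?thesis
    using lam by blast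
qed

end
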